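(* Let $n\ge 1$, $0<q\le 1$ and $t>0$. Let $\mathbf{T}_n(q,t)\subset\mathbb{R}^n$ be the set of $(x_1,\dots,x_n)$ satisfying $x_n\ge 1-q$ and $$q\,x_i\le q(1+t)\,x_{i-1}-t(1-q)(1-x_{j-1})\qquad\text{for all } 1\le j\le i\le n,$$ where $x_0:=1$. Then $$\operatorname{vol}\mathbf{T}_n(q,t)= t^n\,\mathrm{T}_{K_{n+1}}(1+q/t,\,1+t)/n!,$$ where $\mathrm{T}_H(x,y)$ is the Tutte polynomial of the graph $H$ and $K_{n+1}$ is the complete graph on $n+1$ nodes.
   Context: For a graph $G$ with node set $V$, the Tutte polynomial is $\mathrm{T}_G(x,y)=\sum_{H}(x-1)^{k(H)-k(G)}(y-1)^{e(H)-|V|+k(H)}$, the sum over all spanning subgraphs $H$ of $G$ (subgraphs with node set $V$ and any subset of the edges), where $k(\cdot)$ is the number of connected components and $e(\cdot)$ the number of edges. Volume is $n$-dimensional Lebesgue measure. *)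

theory Defs
  imports "HOL-Analysis.Analysis"
begin

text \<open>
  An undirected graph without parallel edges is a pair of a vertex set and an edge set, where an
  edge is the set of its endpoints.
\<close>

type_synonym 'a ugraph = "'a set \<times> 'a set set"

abbreviation nodes :: "'a ugraph \<Rightarrow> 'a set" where
  "nodes G \<equiv> fst G"

abbreviation edges :: "'a ugraph \<Rightarrow> 'a set set" where
  "edges G \<equiv> snd G"

definition connected_rel :: "'a ugraph \<Rightarrow> ('a \<times> 'a) set" where
  "connected_rel G = {(u, v). u \<in> nodes G \<and> v \<in> nodes G \<and> (u, v) \<in> {(a, b). {a, b} \<in> edges G}\<^sup>*}"

definition num_components :: "'a ugraph \<Rightarrow> nat" where
  "num_components G = card (nodes G // connected_rel G)"

definition spanning_subgraphs :: "'a ugraph \<Rightarrow> 'a ugraph set" where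
  "spanning_subgraphs G = {(nodes G, A) |A. A \<subseteq> edges G}"

text \<open>
  The value of the Tutte polynomial at a point. The exponents are natural numbers; for a finite
  graph the truncated subtractions are exact, as a spanning subgraph \<open>H\<close> satisfies
  \<open>k(H) \<ge> k(G)\<close> and \<open>e(H) + k(H) \<ge> |V|\<close>.
\<close>

definition tutte :: "'a ugraph \<Rightarrow> 'r \<Rightarrow> 'r \<Rightarrow> 'r::comm_ring_1" where
  "tutte G x y =
     (\<Sum>H\<in>spanning_subgraphs G.
        (x - 1) ^ (num_components H - num_components G) *
        (y - 1) ^ (card (edges H) + num_components H - card (nodes G)))"

definition complete_graph :: "nat \<Rightarrow> nat ugraph" where
  "complete_graph m = ({..<m}, {e. e \<subseteq> {..<m} \<and> card e = 2})"

text \<open>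
  A point of \<open>\<real>\<^sup>n\<close> is a function on \<open>{1..n}\<close>, extended by \<open>undefined\<close>; the \<open>n\<close>-dimensional
  Lebesgue measure is the completion of the \<open>n\<close>-fold product of the Borel--Lebesgue measure.
\<close>

definition lebesgue_n :: "nat \<Rightarrow> (nat \<Rightarrow> real) measure" where
  "lebesgue_n n = completion (Pi\<^sub>M {1..n} (\<lambda>_. lborel))"

text \<open>The update \<open>x(0 := 1)\<close> encodes the convention that \<open>x\<^sub>0 = 1\<close>.\<close>

definition tutte_polytope :: "nat \<Rightarrow> real \<Rightarrow> real \<Rightarrow> (nat \<Rightarrow> real) set" where
  "tutte_polytope n q t =
     {x \<in> {1..n} \<rightarrow>\<^sub>E UNIV.
        x n \<ge> 1 - q \<and>
        (\<forall>i j. 1 \<le> j \<and> j \<le> i \<and> i \<le> n \<longrightarrow>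
           q * x i \<le> q * (1 + t) * (x(0 := 1)) (i - 1) - t * (1 - q) * (1 - (x(0 := 1)) (j - 1)))}"

end

theory Submission
  imports Defs
begin

text \<open>
  In the coordinates \<open>u\<^sub>i = x\<^sub>i - (1 - q)\<close> the polytope is given by \<open>u\<^sub>0 = q\<close> and
  \<open>0 \<le> u\<^sub>i \<le> (1 + t) u\<^bsub>i-1\<^esub> + t (1 - q) / q * min(u\<^sub>0, \<dots>, u\<^bsub>i-1\<^esub>)\<close>, so its volume obeys a recursion
  whose state is the last coordinate and the running minimum. Cutting the integral of each step at
  the running minimum, the recursion is solved by generating functions: with
  \<open>E(z) = \<Sum>k. (1 + t) ^ (k choose 2) z ^ k / k!\<close>, the volumes started at last
  coordinate \<open>=\<close> minimum \<open>= 1\<close> have generating function \<open>h'\<close>, where \<open>h(0) = 1\<close> and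
  \<open>h' E(z / q) = h E'(z / q)\<close>, that is, \<open>h(z) = E(z / q) ^ q\<close>.
  On the graph side, splitting off the component of one vertex shows that the exponential
  generating function \<open>H\<close> of \<open>\<Sum>A. q ^ k(A) t ^ e(A)\<close> satisfies \<open>H' = q C' H\<close>, where \<open>C\<close> counts
  connected graphs. The case \<open>q = 1\<close> reads \<open>E' = C' E\<close>, so \<open>H = E ^ q\<close> as well.
\<close>

unbundle no vec_syntax
unbundle fps_syntax

section \<open>Spanning subgraphs of complete graphs\<close>

definition complete_edges :: "'a set \<Rightarrow> 'a set set" where
  "complete_edges V = {e. e \<subseteq> V \<and> card e = 2}"

definition adj :: "'a set set \<Rightarrow> ('a \<times> 'a) set" where
  "adj A = {(a, b). {a, b} \<in> A}"

definition component :: "'a set \<Rightarrow> 'a set set \<Rightarrow> 'a \<Rightarrow> 'a set" where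
  "component V A x = {y \<in> V. (x, y) \<in> (adj A)\<^sup>*}"

definition connected_graphs :: "'a set \<Rightarrow> 'a set set set" where
  "connected_graphs V =
     {A. A \<subseteq> complete_edges V \<and> (\<forall>x\<in>V. \<forall>y\<in>V. (x, y) \<in> (adj A)\<^sup>*)}"

lemma finite_complete_edges [simp]: "finite V \<Longrightarrow> finite (complete_edges V)"
  by (rule finite_subset[of _ "Pow V"]) (auto simp: complete_edges_def)

lemma complete_edges_empty [simp]: "complete_edges {} = {}"
  by (auto simp: complete_edges_def)

lemma card_complete_edges: "finite V \<Longrightarrow> card (complete_edges V) = card V choose 2"
  unfolding complete_edges_def by (rule n_subsets)

lemma reach_sym: "(x, y) \<in> (adj A)\<^sup>* \<Longrightarrow> (y, x) \<in> (adj A)\<^sup>*"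
  by (rule symD[OF sym_rtrancl]) (auto simp: sym_def adj_def insert_commute)

lemma num_components_eq: "num_components (V, A) = card (component V A ` V)"
proof -
  have "connected_rel (V, A) `` {x} = component V A x" if "x \<in> V" for x
    using that by (auto simp: connected_rel_def component_def adj_def)
  then have "V // connected_rel (V, A) = component V A ` V"
    by (auto simp: quotient_def)
  then show ?thesis
    by (simp add: num_components_def)
qed

lemma component_eq_iff:
  assumes "x \<in> V" "y \<in> V"
  shows "component V A x = component V A y \<longleftrightarrow> (x, y) \<in> (adj A)\<^sup>*"
proof
  assume "component V A x = component V A y"
  then show "(x, y) \<in> (adj A)\<^sup>*"
    using assms by (auto simp: component_def)
next
  assume "(x, y) \<in> (adj A)\<^sup>*"
  then show "component V A x = component V A y"
    using reach_sym[of x y A] unfolding component_def by (meson rtrancl_trans)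
qed

text \<open>No edge crosses the border of \<open>U\<close>, so a path that starts in
  \<open>U\<close> cannot leave it and uses only edges inside \<open>U\<close>.\<close>

lemma reach_closed:
  assumes closed: "\<And>e. e \<in> A \<Longrightarrow> e \<subseteq> U \<or> e \<inter> U = {}" and "x \<in> U"
    and "(x, y) \<in> (adj A)\<^sup>*"
  shows "y \<in> U \<and> (x, y) \<in> (adj (A \<inter> Pow U))\<^sup>*"
  using assms(3)
proof (induction rule: rtrancl_induct)
  case base
  then show ?case using \<open>x \<in> U\<close> by simp
next
  case (step y z)
  have "{y, z} \<in> A" using step by (simp add: adj_def)
  moreover from this have "{y, z} \<subseteq> U" using closed[of "{y, z}"] step by auto
  ultimately have "(y, z) \<in> adj (A \<inter> Pow U)" by (simp add: adj_def)
  with step \<open>{y, z} \<subseteq> U\<close> show ?case by auto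
qed

lemma reach_mono: "A \<subseteq> B \<Longrightarrow> (x, y) \<in> (adj A)\<^sup>* \<Longrightarrow> (x, y) \<in> (adj B)\<^sup>*"
  using rtrancl_mono[of "adj A" "adj B"] by (auto simp: adj_def)

lemma component_closed:
  assumes "\<And>e. e \<in> A \<Longrightarrow> e \<subseteq> U \<or> e \<inter> U = {}" and "U \<subseteq> V" and "x \<in> U"
  shows "component V A x = component U (A \<inter> Pow U) x"
  unfolding component_def
  using reach_closed[OF assms(1,3)] reach_mono[of "A \<inter> Pow U" A] \<open>U \<subseteq> V\<close> by blast

section \<open>Splitting off the component of one vertex\<close>

text \<open>No edge of \<open>A1 \<union> A2\<close> runs between \<open>insert v S\<close> and
  \<open>V - S\<close>, so \<open>component_closed\<close> applies to either side. The last two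
  equations recover both edge sets from their union.\<close>

lemma component_join:
  assumes "v \<notin> V" "S \<subseteq> V"
    and A1: "A1 \<in> connected_graphs (insert v S)" and A2: "A2 \<subseteq> complete_edges (V - S)"
  shows "component (insert v V) (A1 \<union> A2) v = insert v S"
    and "x \<in> V - S \<Longrightarrow> component (insert v V) (A1 \<union> A2) x = component (V - S) A2 x"
    and "x \<in> insert v S \<Longrightarrow> component (insert v V) (A1 \<union> A2) x = insert v S"
    and "(A1 \<union> A2) \<inter> Pow (insert v S) = A1"
    and "(A1 \<union> A2) \<inter> Pow (V - S) = A2"
proof -
  \<comment> \<open>Nonemptiness matters: the empty set would lie in the power sets of both
    sides.\<close>
  have E1: "e \<subseteq> insert v S" "e \<noteq> {}" if "e \<in> A1" for e
    using that A1 by (auto simp: connected_graphs_def complete_edges_def)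
  have E2: "e \<subseteq> V - S" "e \<noteq> {}" if "e \<in> A2" for e
    using that A2 by (auto simp: complete_edges_def)
  have disj: "insert v S \<inter> (V - S) = {}"
    using \<open>v \<notin> V\<close> by auto
  have N1: "\<not> e \<subseteq> V - S" "e \<inter> (V - S) = {}" if "e \<in> A1" for e
    using E1[OF that] disj by auto
  have N2: "\<not> e \<subseteq> insert v S" "e \<inter> insert v S = {}" if "e \<in> A2" for e
    using E2[OF that] disj by auto
  show i1: "(A1 \<union> A2) \<inter> Pow (insert v S) = A1"
    using E1(1) N2(1) by auto
  show i2: "(A1 \<union> A2) \<inter> Pow (V - S) = A2"
    using E2(1) N1(1) by auto
  have cl1: "e \<subseteq> insert v S \<or> e \<inter> insert v S = {}" if "e \<in> A1 \<union> A2" for e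
    using that E1(1) N2(2) by auto
  have cl2: "e \<subseteq> V - S \<or> e \<inter> (V - S) = {}" if "e \<in> A1 \<union> A2" for e
    using that E2(1) N1(2) by auto
  show c1: "component (insert v V) (A1 \<union> A2) x = insert v S" if "x \<in> insert v S" for x
  proof -
    have "component (insert v V) (A1 \<union> A2) x = component (insert v S) A1 x"
      using cl1 that i1 \<open>S \<subseteq> V\<close> by (subst component_closed[where U = "insert v S"]) auto
    also have "\<dots> = insert v S"
      using A1 that by (auto simp: connected_graphs_def component_def)
    finally show ?thesis .
  qed
  show "component (insert v V) (A1 \<union> A2) v = insert v S"
    by (rule c1) simp
  show "component (insert v V) (A1 \<union> A2) x = component (V - S) A2 x" if "x \<in> V - S" for x
    using cl2 that i2 by (subst component_closed[where U = "V - S"]) auto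
qed

text \<open>The components of \<open>A2\<close> stay as they are, and the one extra component is new
  because it contains \<open>v\<close>.\<close>

lemma num_components_join:
  assumes "finite V" "v \<notin> V" "S \<subseteq> V"
    and A1: "A1 \<in> connected_graphs (insert v S)" and A2: "A2 \<subseteq> complete_edges (V - S)"
  shows "num_components (insert v V, A1 \<union> A2) = Suc (num_components (V - S, A2))"
proof -
  note j = component_join[OF assms(2-5)]
  have "insert v V = insert v S \<union> (V - S)"
    using \<open>S \<subseteq> V\<close> by auto
  then have "component (insert v V) (A1 \<union> A2) ` insert v V
      = component (insert v V) (A1 \<union> A2) ` insert v S \<union> component (insert v V) (A1 \<union> A2) ` (V - S)"
    by (metis image_Un)
  also have "component (insert v V) (A1 \<union> A2) ` insert v S = {insert v S}"
    using j(3) by force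
  also have "component (insert v V) (A1 \<union> A2) ` (V - S) = component (V - S) A2 ` (V - S)"
    using j(2) by (rule image_cong[OF refl])
  finally have "component (insert v V) (A1 \<union> A2) ` insert v V
      = insert (insert v S) (component (V - S) A2 ` (V - S))" by simp
  moreover have "insert v S \<notin> component (V - S) A2 ` (V - S)"
    using \<open>v \<notin> V\<close> by (auto simp: component_def)
  ultimately show ?thesis
    using \<open>finite V\<close> by (simp add: num_components_eq)
qed

text \<open>The inverse reads \<open>S\<close> off the component of \<open>v\<close> and then sorts
  the edges by the side they lie on.\<close>

lemma bij_betw_component_decomposition:
  assumes "v \<notin> V"
  shows "bij_betw (\<lambda>(S, A1, A2). A1 \<union> A2)
    (SIGMA S:Pow V. connected_graphs (insert v S) \<times> Pow (complete_edges (V - S)))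
    (Pow (complete_edges (insert v V)))"
proof (rule bij_betw_byWitness[where f' = "\<lambda>A. let S = component (insert v V) A v - {v} in
    (S, A \<inter> Pow (insert v S), A \<inter> Pow (V - S))"])
  show "\<forall>p\<in>SIGMA S:Pow V. connected_graphs (insert v S) \<times> Pow (complete_edges (V - S)).
      (let S = component (insert v V) (case p of (S, A1, A2) \<Rightarrow> A1 \<union> A2) v - {v} in
        (S, (case p of (S, A1, A2) \<Rightarrow> A1 \<union> A2) \<inter> Pow (insert v S),
         (case p of (S, A1, A2) \<Rightarrow> A1 \<union> A2) \<inter> Pow (V - S))) = p"
  proof (rule ballI, clarify)
    fix S A1 A2
    assume S: "S \<subseteq> V" and A1: "A1 \<in> connected_graphs (insert v S)"
      and A2: "A2 \<subseteq> complete_edges (V - S)"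
    note j = component_join[OF assms S A1 A2]
    have "insert v S - {v} = S"
      using assms S by auto
    then show "(let S = component (insert v V) (A1 \<union> A2) v - {v} in
        (S, (A1 \<union> A2) \<inter> Pow (insert v S), (A1 \<union> A2) \<inter> Pow (V - S))) = (S, A1, A2)"
      using j(1,4,5) by (simp add: Let_def)
  qed
  show "(\<lambda>(S, A1, A2). A1 \<union> A2) `
      (SIGMA S:Pow V. connected_graphs (insert v S) \<times> Pow (complete_edges (V - S)))
      \<subseteq> Pow (complete_edges (insert v V))"
    unfolding connected_graphs_def complete_edges_def by auto
  \<comment> \<open>One statement about an arbitrary edge set \<open>A\<close> serves two
    obligations: gluing undoes splitting, and splitting lands in the right set.\<close>
  have dec: "(case let S = component (insert v V) A v - {v} in
      (S, A \<inter> Pow (insert v S), A \<inter> Pow (V - S)) of (S, A1, A2) \<Rightarrow> A1 \<union> A2) = A \<and>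
    (let S = component (insert v V) A v - {v} in (S, A \<inter> Pow (insert v S), A \<inter> Pow (V - S)))
      \<in> (SIGMA S:Pow V. connected_graphs (insert v S) \<times> Pow (complete_edges (V - S)))"
    if A: "A \<subseteq> complete_edges (insert v V)" for A
  proof -
    define U where "U = component (insert v V) A v"
    have v: "v \<in> U" and "U \<subseteq> insert v V"
      by (auto simp: U_def component_def)
    have "V - (U - {v}) = insert v V - U"
      using v assms by auto
    have E: "e \<subseteq> insert v V" "card e = 2" if "e \<in> A" for e
      using that A by (auto simp: complete_edges_def)
    \<comment> \<open>The two ends of an edge are reachable from \<open>v\<close> together or not at
      all.\<close>
    have cl: "e \<subseteq> U \<or> e \<inter> U = {}" if "e \<in> A" for e
    proof -
      from E(2)[OF that] obtain a b where e: "e = {a, b}"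
        by (auto simp: card_2_iff)
      have "(a, b) \<in> adj A" "(b, a) \<in> adj A"
        using that by (auto simp: adj_def e insert_commute)
      then have "a \<in> U \<longleftrightarrow> b \<in> U"
        using E(1)[OF that] by (auto simp: U_def component_def e intro: rtrancl_into_rtrancl)
      then show ?thesis
        by (auto simp: e)
    qed
    have "A \<inter> Pow U \<union> A \<inter> Pow (insert v V - U) = A"
      using cl E(1) by blast
    moreover have "A \<inter> Pow U \<in> connected_graphs U"
    proof -
      have reach: "(v, x) \<in> (adj (A \<inter> Pow U))\<^sup>*" if "x \<in> U" for x
        using reach_closed[of A U v x] cl v that by (auto simp: U_def component_def)
      then have "(x, y) \<in> (adj (A \<inter> Pow U))\<^sup>*" if "x \<in> U" "y \<in> U" for x y
        using that by (meson reach_sym rtrancl_trans)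
      then show ?thesis
        using E(2) by (auto simp: connected_graphs_def complete_edges_def)
    qed
    moreover have "A \<inter> Pow (insert v V - U) \<subseteq> complete_edges (insert v V - U)"
      using E(2) by (auto simp: complete_edges_def)
    moreover have "U - {v} \<subseteq> V"
      using \<open>U \<subseteq> insert v V\<close> by auto
    ultimately show ?thesis
      unfolding U_def[symmetric] Let_def
      by (simp add: insert_absorb[OF v] \<open>V - (U - {v}) = insert v V - U\<close>)
  qed
  show "\<forall>A\<in>Pow (complete_edges (insert v V)).
      (case let S = component (insert v V) A v - {v} in
        (S, A \<inter> Pow (insert v S), A \<inter> Pow (V - S)) of (S, A1, A2) \<Rightarrow> A1 \<union> A2) = A"
    by (intro ballI conjunct1[OF dec] PowD)
  show "(\<lambda>A. let S = component (insert v V) A v - {v} in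
        (S, A \<inter> Pow (insert v S), A \<inter> Pow (V - S))) ` Pow (complete_edges (insert v V))
      \<subseteq> (SIGMA S:Pow V. connected_graphs (insert v S) \<times> Pow (complete_edges (V - S)))"
    by (intro image_subsetI conjunct2[OF dec] PowD)
qed

section \<open>Weighted counts of graphs and of connected graphs\<close>

text \<open>The random-cluster (Fortuin-Kasteleyn) partition function of the complete graph on
  \<open>V\<close>.\<close>

definition cluster_sum :: "real \<Rightarrow> real \<Rightarrow> 'a set \<Rightarrow> real" where
  "cluster_sum q t V = (\<Sum>A\<in>Pow (complete_edges V). q ^ num_components (V, A) * t ^ card A)"

definition connected_sum :: "real \<Rightarrow> 'a set \<Rightarrow> real" where
  "connected_sum t V = (\<Sum>A\<in>connected_graphs V. t ^ card A)"

text \<open>The weight is multiplicative along the decomposition: the component of \<open>v\<close>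
  supplies one factor \<open>q\<close>, and the two edge sets are disjoint.\<close>

lemma cluster_sum_insert:
  assumes "finite V" "v \<notin> V"
  shows "cluster_sum q t (insert v V)
    = (\<Sum>S\<in>Pow V. q * connected_sum t (insert v S) * cluster_sum q t (V - S))"
proof -
  let ?w = "\<lambda>A. q ^ num_components (insert v V, A) * t ^ card A"
  have fin: "finite (connected_graphs (insert v S))" "finite (Pow (complete_edges (V - S)))"
    if "S \<in> Pow V" for S
  proof -
    have "finite S"
      using that assms(1) finite_subset by auto
    then have "finite (Pow (complete_edges (insert v S)))"
      by simp
    then show "finite (connected_graphs (insert v S))"
      by (rule finite_subset[rotated]) (auto simp: connected_graphs_def)
    show "finite (Pow (complete_edges (V - S)))"
      using assms(1) by simp
  qed
  have "cluster_sum q t (insert v V)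
      = (\<Sum>p\<in>(SIGMA S:Pow V. connected_graphs (insert v S) \<times> Pow (complete_edges (V - S))).
          ?w (case p of (S, A1, A2) \<Rightarrow> A1 \<union> A2))"
    unfolding cluster_sum_def
    by (rule sum.reindex_bij_betw[symmetric, OF bij_betw_component_decomposition[OF assms(2)]])
  also have "\<dots> = (\<Sum>S\<in>Pow V. \<Sum>(A1, A2)\<in>connected_graphs (insert v S) \<times> Pow (complete_edges (V - S)).
      ?w (A1 \<union> A2))"
    using fin assms(1) by (subst sum.Sigma) (auto intro!: sum.cong)
  also have "\<dots> = (\<Sum>S\<in>Pow V. q * connected_sum t (insert v S) * cluster_sum q t (V - S))"
  proof (rule sum.cong[OF refl])
    fix S assume S: "S \<in> Pow V"
    have "?w (A1 \<union> A2) = q * t ^ card A1 * (q ^ num_components (V - S, A2) * t ^ card A2)"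
      if A: "A1 \<in> connected_graphs (insert v S)" "A2 \<in> Pow (complete_edges (V - S))" for A1 A2
    proof -
      have "finite A1" "finite A2"
        using A S assms(1) finite_subset[of A1 "complete_edges (insert v S)"]
          finite_subset[of A2 "complete_edges (V - S)"] finite_subset[of S V]
        by (auto simp: connected_graphs_def)
      moreover have "A1 \<inter> A2 = {}"
      proof -
        have disj: "insert v S \<inter> (V - S) = {}"
          using assms(2) by auto
        have "e \<notin> complete_edges (V - S)" if "e \<in> complete_edges (insert v S)" for e
        proof
          assume "e \<in> complete_edges (V - S)"
          with that have "e \<subseteq> insert v S \<inter> (V - S)" "card e = 2"
            by (auto simp: complete_edges_def)
          then show False
            unfolding disj by simp
        qed
        then show ?thesis using A by (auto simp: connected_graphs_def)
      qed
      ultimately have "card (A1 \<union> A2) = card A1 + card A2"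
        by (rule card_Un_disjoint)
      then show ?thesis
        using num_components_join[OF assms, of S A1 A2] A S by (simp add: power_add)
    qed
    then have "(\<Sum>(A1, A2)\<in>connected_graphs (insert v S) \<times> Pow (complete_edges (V - S)). ?w (A1 \<union> A2))
       = (\<Sum>(A1, A2)\<in>connected_graphs (insert v S) \<times> Pow (complete_edges (V - S)).
         q * t ^ card A1 * (q ^ num_components (V - S, A2) * t ^ card A2))"
      by (intro sum.cong) auto
    also have "\<dots> = (\<Sum>A1\<in>connected_graphs (insert v S). q * t ^ card A1) * cluster_sum q t (V - S)"
      by (simp add: cluster_sum_def sum_product sum.cartesian_product)
    finally show "(\<Sum>(A1, A2)\<in>connected_graphs (insert v S) \<times> Pow (complete_edges (V - S)). ?w (A1 \<union> A2))
       = q * connected_sum t (insert v S) * cluster_sum q t (V - S)"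
      by (simp add: connected_sum_def sum_distrib_left)
  qed
  finally show ?thesis .
qed

text \<open>With \<open>q = 1\<close> components carry no weight, so each edge independently
  contributes \<open>1 + t\<close>.\<close>

lemma cluster_sum_1: "finite V \<Longrightarrow> cluster_sum 1 t V = (1 + t) ^ (card V choose 2)"
  using prod_add[of "complete_edges V" "\<lambda>_. t" "\<lambda>_. 1"]
  by (simp add: cluster_sum_def card_complete_edges add.commute)

section \<open>Dependence on the number of vertices only, and the resulting recurrence\<close>

lemma sum_Pow_bij:
  assumes "bij_betw f S S'" and "\<And>R. R \<subseteq> S \<Longrightarrow> g R = h (f ` R)"
  shows "sum g (Pow S) = sum h (Pow S')"
proof -
  have b: "bij_betw ((`) f) (Pow S) (Pow S')"
    by (rule bij_betw_Pow[OF assms(1)])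
  have "sum g (Pow S) = (\<Sum>R\<in>Pow S. h (f ` R))"
    using assms(2) by (intro sum.cong) auto
  also have "\<dots> = sum h (Pow S')"
    by (rule sum.reindex_bij_betw[OF b])
  finally show ?thesis .
qed

lemma sum_proper_Pow_bij:
  assumes "bij_betw f S S'" and "\<And>R. R \<subset> S \<Longrightarrow> g R = h (f ` R)"
  shows "sum g (Pow S - {S}) = sum h (Pow S' - {S'})"
proof -
  have b: "bij_betw ((`) f) (Pow S) (Pow S')"
    by (rule bij_betw_Pow[OF assms(1)])
  have "f ` S = S'"
    using assms(1) by (simp add: bij_betw_def)
  then have b': "bij_betw ((`) f) (Pow S - {S}) (Pow S' - {S'})"
    using bij_betw_DiffI[OF b, of "{S}" "{S'}"] by (auto simp: bij_betw_def)
  have "sum g (Pow S - {S}) = (\<Sum>R\<in>Pow S - {S}. h (f ` R))"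
    using assms(2) by (intro sum.cong) auto
  also have "\<dots> = sum h (Pow S' - {S'})"
    by (rule sum.reindex_bij_betw[OF b'])
  finally show ?thesis .
qed

text \<open>The recurrence at \<open>q = 1\<close> solved for its term \<open>R = S\<close>, whose
  second factor is the empty graph's weight 1.\<close>

lemma connected_sum_eq:
  assumes "finite S" "v \<notin> S"
  shows "connected_sum t (insert v S) = (1 + t) ^ (Suc (card S) choose 2)
    - (\<Sum>R\<in>Pow S - {S}. connected_sum t (insert v R) * (1 + t) ^ (card (S - R) choose 2))"
proof -
  have "(1 + t) ^ (Suc (card S) choose 2)
      = (\<Sum>R\<in>Pow S. connected_sum t (insert v R) * cluster_sum 1 t (S - R))"
    using cluster_sum_insert[OF assms, of 1 t] assms by (simp add: cluster_sum_1)
  also have "\<dots> = (\<Sum>R\<in>Pow S. connected_sum t (insert v R) * (1 + t) ^ (card (S - R) choose 2))"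
    using assms(1) by (simp add: cluster_sum_1)
  also have "\<dots> = connected_sum t (insert v S)
      + (\<Sum>R\<in>Pow S - {S}. connected_sum t (insert v R) * (1 + t) ^ (card (S - R) choose 2))"
    using assms(1) by (subst sum.remove[of _ S]) (auto simp: numeral_2_eq_2)
  finally show ?thesis by simp
qed

lemma card_Diff_image:
  assumes "bij_betw f S S'" "R \<subseteq> S"
  shows "card (S' - f ` R) = card (S - R)"
proof -
  have "S' - f ` R = f ` (S - R)"
    using assms by (auto simp: bij_betw_def inj_on_def)
  then show ?thesis
    using assms by (metis Diff_subset bij_betw_def card_image inj_on_subset)
qed

text \<open>
  The recurrence at \<open>q = 1\<close> determines \<open>connected_sum\<close> from cardinalities alone, so relabelling
  invariance needs no graph isomorphisms.
\<close>

lemma connected_sum_card: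
  assumes "finite S" "finite S'" "card S = card S'" "v \<notin> S" "v' \<notin> S'"
  shows "connected_sum t (insert v S) = connected_sum t (insert v' S')"
  using assms
proof (induction "card S" arbitrary: S S' rule: less_induct)
  case less
  obtain f where f: "bij_betw f S S'"
    using less.prems finite_same_card_bij by blast
  have "(\<Sum>R\<in>Pow S - {S}. connected_sum t (insert v R) * (1 + t) ^ (card (S - R) choose 2))
      = (\<Sum>R\<in>Pow S' - {S'}. connected_sum t (insert v' R) * (1 + t) ^ (card (S' - R) choose 2))"
    (is "sum ?g _ = sum ?h _")
  proof -
    have "?g R = ?h (f ` R)" if "R \<subset> S" for R
    proof -
      have "card R = card (f ` R)"
        using f that by (metis bij_betw_def card_image inj_on_subset psubset_imp_subset)
      moreover have "card R < card S"
        using that less.prems(1) psubset_card_mono by auto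
      moreover have "f ` R \<subseteq> S'"
        using f that by (auto simp: bij_betw_def)
      ultimately have "connected_sum t (insert v R) = connected_sum t (insert v' (f ` R))"
        using less.prems that by (intro less.hyps) (auto intro: finite_subset)
      then show ?thesis
        using card_Diff_image[OF f, of R] that by auto
    qed
    then show ?thesis
      by (rule sum_proper_Pow_bij[OF f])
  qed
  then show ?case
    using less.prems by (simp add: connected_sum_eq)
qed

text \<open>Remove a vertex on each side and carry subsets along a bijection of the rest. In
  \<open>cluster_sum_insert\<close> the connected factors then agree by
  \<open>connected_sum_card\<close>, the others by induction.\<close>

lemma cluster_sum_card:
  assumes "finite S" "finite S'" "card S = card S'"
  shows "cluster_sum q t S = cluster_sum q t S'"
  using assms
proof (induction "card S" arbitrary: S S' rule: less_induct)
  case less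
  show ?case
  proof (cases "S = {}")
    case True
    then show ?thesis
      using less.prems by (simp add: cluster_sum_def num_components_eq)
  next
    case False
    then obtain v R where S: "S = insert v R" "v \<notin> R"
      by (metis Set.set_insert ex_in_conv)
    have "S' \<noteq> {}"
      using False less.prems by auto
    then obtain v' R' where S': "S' = insert v' R'" "v' \<notin> R'"
      by (metis Set.set_insert ex_in_conv)
    have fin: "finite R" "finite R'" "card R = card R'" "card R < card S"
      using less.prems S S' by auto
    obtain f where f: "bij_betw f R R'"
      using fin finite_same_card_bij by blast
    have "q * connected_sum t (insert v T) * cluster_sum q t (R - T)
        = q * connected_sum t (insert v' (f ` T)) * cluster_sum q t (R' - f ` T)" if "T \<subseteq> R" for T
    proof -
      have "connected_sum t (insert v T) = connected_sum t (insert v' (f ` T))"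
        using f that fin S S'
        by (intro connected_sum_card)
          (auto simp: bij_betw_def finite_subset card_image inj_on_subset)
      moreover have "cluster_sum q t (R - T) = cluster_sum q t (R' - f ` T)"
      proof (rule less.hyps)
        show "card (R - T) < card S"
          using fin card_mono[of R "R - T"] by (auto intro: le_less_trans)
      qed (use fin card_Diff_image[OF f that] in auto)
      ultimately show ?thesis by simp
    qed
    then show ?thesis
      unfolding S S' cluster_sum_insert[OF fin(1) S(2)] cluster_sum_insert[OF fin(2) S'(2)]
      by (intro sum_Pow_bij[OF f])
  qed
qed

lemma sum_Pow_card:
  fixes g :: "nat \<Rightarrow> 'b::comm_semiring_1"
  assumes "finite S"
  shows "(\<Sum>R\<in>Pow S. g (card R)) = (\<Sum>k\<le>card S. of_nat (card S choose k) * g k)"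
proof -
  have "(\<Sum>R\<in>Pow S. g (card R)) = (\<Sum>k\<le>card S. \<Sum>R\<in>{R \<in> Pow S. card R = k}. g (card R))"
    using assms by (intro sum.group[symmetric]) (auto simp: card_mono)
  also have "\<dots> = (\<Sum>k\<le>card S. of_nat (card S choose k) * g k)"
    using assms by (intro sum.cong) (auto simp: n_subsets)
  finally show ?thesis .
qed

text \<open>Grouping the sets \<open>S\<close> by size turns the recurrence into a binomial
  convolution, ready for generating functions. The set \<open>{..k}\<close> has \<open>k + 1\<close>
  elements: \<open>v\<close> and the \<open>k\<close> elements of \<open>S\<close>.\<close>

lemma cluster_sum_Suc:
  "cluster_sum q t {..<Suc n} = (\<Sum>k\<le>n. of_nat (n choose k) *
     (q * connected_sum t {..k} * cluster_sum q t {..<n - k}))"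
proof -
  have "cluster_sum q t {..<Suc n}
      = (\<Sum>S\<in>Pow {..<n}. q * connected_sum t (insert n S) * cluster_sum q t ({..<n} - S))"
    unfolding lessThan_Suc by (rule cluster_sum_insert) auto
  also have "\<dots> = (\<Sum>S\<in>Pow {..<n}. q * connected_sum t {..card S} * cluster_sum q t {..<n - card S})"
  proof (rule sum.cong[OF refl])
    fix S assume S: "S \<in> Pow {..<n}"
    then have fin: "finite S"
      using finite_subset by auto
    have "connected_sum t (insert n S) = connected_sum t (insert (card S) {..<card S})"
      using S fin by (intro connected_sum_card) auto
    moreover have "insert (card S) {..<card S} = {..card S}" by auto
    moreover have "cluster_sum q t ({..<n} - S) = cluster_sum q t {..<n - card S}"
      using S fin by (intro cluster_sum_card) (auto simp: card_Diff_subset)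
    ultimately show "q * connected_sum t (insert n S) * cluster_sum q t ({..<n} - S)
        = q * connected_sum t {..card S} * cluster_sum q t {..<n - card S}" by simp
  qed
  also have "\<dots> = (\<Sum>k\<le>n. of_nat (n choose k) *
     (q * connected_sum t {..k} * cluster_sum q t {..<n - k}))"
    by (subst sum_Pow_card) auto
  finally show ?thesis .
qed

section \<open>From the Tutte polynomial to the cluster sum\<close>

lemma num_components_pos:
  assumes "finite V" "V \<noteq> {}"
  shows "num_components (V, A) > 0"
  using assms by (simp add: num_components_eq card_gt_0_iff)

lemma num_components_empty: "num_components (V, {}) = card V"
proof -
  have "component V {} x = {x}" if "x \<in> V" for x
    using that by (auto simp: component_def adj_def)
  then have "component V {} ` V = (\<lambda>x. {x}) ` V"
    by auto
  then show ?thesis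
    by (simp add: num_components_eq card_image)
qed

lemma reach_insert_edge:
  assumes "(x, y) \<in> (adj (insert {a, b} A))\<^sup>*"
  shows "(x, y) \<in> (adj A)\<^sup>* \<or>
    ((x, a) \<in> (adj A)\<^sup>* \<or> (x, b) \<in> (adj A)\<^sup>*) \<and> ((a, y) \<in> (adj A)\<^sup>* \<or> (b, y) \<in> (adj A)\<^sup>*)"
  using assms
proof (induction rule: rtrancl_induct)
  case base
  then show ?case by simp
next
  case (step y z)
  then have "(y, z) \<in> adj A \<or> y = a \<and> z = b \<or> y = b \<and> z = a"
    by (auto simp: adj_def doubleton_eq_iff)
  with step.IH show ?case
    by (auto intro: rtrancl_into_rtrancl)
qed

text \<open>An edge merges at most two components: sending each old component to the new one around
  it is injective once the component of \<open>b\<close> is left out.\<close>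

lemma num_components_insert_edge:
  assumes "finite V" "a \<in> V" "b \<in> V"
  shows "num_components (V, A) \<le> Suc (num_components (V, insert {a, b} A))"
proof -
  let ?A' = "insert {a, b} A"
  let ?B = "component V A b"
  define g where "g X = component V ?A' (SOME x. x \<in> V \<and> component V A x = X)" for X
  have g: "g (component V A x) = component V ?A' x" if x: "x \<in> V" for x
  proof -
    define y where "y = (SOME y. y \<in> V \<and> component V A y = component V A x)"
    have "y \<in> V \<and> component V A y = component V A x"
      unfolding y_def by (rule someI) (use x in auto)
    then have "component V ?A' y = component V ?A' x"
      using x reach_mono[of A ?A' y x] component_eq_iff[of y V x]
      by (simp add: subset_insertI)
    then show ?thesis by (simp add: g_def y_def)
  qed
  have "inj_on g (component V A ` V - {?B})"
  proof (rule inj_onI, clarsimp)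
    fix x y assume x: "x \<in> V" "component V A x \<noteq> ?B" and y: "y \<in> V" "component V A y \<noteq> ?B"
      and "g (component V A x) = g (component V A y)"
    then have "(x, y) \<in> (adj ?A')\<^sup>*"
      by (simp add: g component_eq_iff)
    \<comment> \<open>With no link to \<open>b\<close>, a path through the new edge would force both
      \<open>x\<close> and \<open>y\<close> to be linked to \<open>a\<close>, hence to each
      other.\<close>
    moreover have "(x, b) \<notin> (adj A)\<^sup>*" "(b, y) \<notin> (adj A)\<^sup>*"
      using x y assms by (auto simp: component_eq_iff intro: reach_sym)
    ultimately have "(x, y) \<in> (adj A)\<^sup>*"
      using reach_insert_edge[of x y a b A] by (meson rtrancl_trans)
    then show "component V A x = component V A y"
      using x y by (simp add: component_eq_iff)
  qed
  moreover have "g ` (component V A ` V - {?B}) \<subseteq> component V ?A' ` V"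
    using g by auto
  ultimately have "card (component V A ` V - {?B}) \<le> card (component V ?A' ` V)"
    using assms(1) by (intro card_inj_on_le[of g]) auto
  then show ?thesis
    using assms by (simp add: num_components_eq card_Diff_singleton_if)
qed

text \<open>The edgeless graph has \<open>card V\<close> components and each added edge removes at
  most one. This makes the truncated exponent of \<open>y - 1\<close> in \<open>tutte\<close>
  exact.\<close>

lemma card_le_edges_plus_components:
  assumes "finite V" "A \<subseteq> complete_edges V"
  shows "card V \<le> card A + num_components (V, A)"
proof -
  have "finite A"
    by (rule finite_subset[OF assms(2)]) (use assms(1) in simp)
  then show ?thesis
    using assms(2)
  proof (induction A)
    case empty
    then show ?case by (simp add: num_components_empty)
  next
    case (insert e A)
    obtain a b where "e = {a, b}" "a \<in> V" "b \<in> V"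
      using insert.prems by (auto simp: complete_edges_def card_2_iff)
    then show ?case
      using insert num_components_insert_edge[OF assms(1), of a b A] by auto
  qed
qed

lemma num_components_complete:
  assumes "finite V" "V \<noteq> {}"
  shows "num_components (V, complete_edges V) = 1"
proof -
  have "component V (complete_edges V) x = V" if "x \<in> V" for x
  proof -
    have "(x, y) \<in> (adj (complete_edges V))\<^sup>*" if "y \<in> V" for y
    proof (cases "x = y")
      case False
      then show ?thesis
        using that \<open>x \<in> V\<close> by (intro r_into_rtrancl) (auto simp: adj_def complete_edges_def)
    qed simp
    then show ?thesis by (auto simp: component_def)
  qed
  then have "component V (complete_edges V) ` V = {V}"
    using assms(2) by (simp add: image_constant_conv)
  then show ?thesis
    by (simp add: num_components_eq)
qed

text \<open>For a subgraph with \<open>k\<close> components and \<open>e\<close> edges the power of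
  \<open>t\<close> is \<open>n - (k - 1) + (e + k - (n + 1)) = e\<close>, and that of
  \<open>q\<close> is \<open>k - 1\<close>.\<close>

lemma tutte_complete_graph:
  assumes "q \<noteq> 0" "t \<noteq> 0"
  shows "t ^ n * tutte (complete_graph (n + 1)) (1 + q / t) (1 + t) = cluster_sum q t {..<Suc n} / q"
proof -
  let ?V = "{..<Suc n}"
  have cg: "complete_graph (n + 1) = (?V, complete_edges ?V)"
    by (simp add: complete_graph_def complete_edges_def)
  have sp: "spanning_subgraphs (?V, complete_edges ?V) = Pair ?V ` Pow (complete_edges ?V)"
    by (auto simp: spanning_subgraphs_def)
  have "t ^ n * ((q / t) ^ (num_components (?V, A) - 1) * t ^ (card A + num_components (?V, A) - Suc n))
      = q ^ num_components (?V, A) * t ^ card A / q" if "A \<subseteq> complete_edges ?V" for A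
  proof -
    obtain k where k: "num_components (?V, A) = Suc k"
      using num_components_pos[of ?V A] gr0_implies_Suc by (auto simp: lessThan_empty_iff)
    have "n \<le> card A + k"
      using card_le_edges_plus_components[OF _ that] k by simp
    then have "t ^ n * t ^ (card A + k - n) = t ^ card A * t ^ k"
      by (simp add: power_add[symmetric])
    then show ?thesis
      using assms by (simp add: k power_divide field_simps)
  qed
  then show ?thesis
    using num_components_complete[of ?V]
    unfolding cg by (simp add: tutte_def sp sum.reindex inj_on_def cluster_sum_def sum_distrib_left
        sum_divide_distrib lessThan_empty_iff)
qed

section \<open>The volume recursion\<close>


lemma fps_mult_egf:
  fixes a b c :: "nat \<Rightarrow> real"
  assumes "r \<noteq> 0" and "\<And>n. a n = (\<Sum>k\<le>n. of_nat (n choose k) * (b k * c (n - k)))"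
  shows "Abs_fps (\<lambda>n. a n / (r ^ n * fact n))
    = Abs_fps (\<lambda>n. b n / (r ^ n * fact n)) * Abs_fps (\<lambda>n. c n / (r ^ n * fact n))"
proof (rule fps_ext)
  fix n
  have "of_nat (n choose k) * (b k * c (n - k)) / (r ^ n * fact n)
      = b k / (r ^ k * fact k) * (c (n - k) / (r ^ (n - k) * fact (n - k)))" if "k \<le> n" for k
  proof -
    have "r ^ n = r ^ k * r ^ (n - k)"
      using that by (simp add: power_add[symmetric])
    then show ?thesis
      using that assms(1) by (simp add: binomial_fact field_simps)
  qed
  then show "Abs_fps (\<lambda>n. a n / (r ^ n * fact n)) $ n
      = (Abs_fps (\<lambda>n. b n / (r ^ n * fact n)) * Abs_fps (\<lambda>n. c n / (r ^ n * fact n))) $ n"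
    by (simp add: fps_mult_nth assms(2) sum_divide_distrib atLeast0AtMost)
qed

lemma measurable_coordinate:
  "i \<in> I \<Longrightarrow> (\<lambda>x. x i) \<in> borel_measurable (Pi\<^sub>M I (\<lambda>_. lborel))"
  using measurable_component_singleton[of i I "\<lambda>_. lborel"] by simp

locale tutte_parameters =
  fixes q t :: real
  assumes q_pos: "0 < q" and q_le_1: "q \<le> 1" and t_pos: "0 < t"
begin

text \<open>The egf's are rescaled by \<open>z \<mapsto> z / q\<close>, which makes \<open>vol\<close> below homogeneous in \<open>a, m\<close>.\<close>

definition cluster_fps :: "real fps" where
  "cluster_fps = Abs_fps (\<lambda>n. cluster_sum q t {..<n} / (q ^ n * fact n))"

definition graph_fps :: "real fps" where
  "graph_fps = Abs_fps (\<lambda>n. (1 + t) ^ (n choose 2) / (q ^ n * fact n))"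

text \<open>This is \<open>E'(z / q)\<close>, not the derivative of \<open>E(z / q)\<close>, which
  has an extra factor \<open>1 / q\<close>.\<close>

definition shifted_graph_fps :: "real fps" where
  "shifted_graph_fps = Abs_fps (\<lambda>n. (1 + t) ^ (Suc n choose 2) / (q ^ n * fact n))"

definition connected_fps :: "real fps" where
  "connected_fps = Abs_fps (\<lambda>n. connected_sum t {..n} / (q ^ n * fact n))"

text \<open>The series \<open>h(z) / E(z / q)\<close>, mathematically \<open>E(z / q)\<close> to the
  power \<open>q - 1\<close>.\<close>

definition quotient_fps :: "real fps" where
  "quotient_fps = cluster_fps * inverse graph_fps"

text \<open>The equation \<open>E' = C' E\<close> at \<open>z / q\<close>, from the vertex
  recurrence with \<open>q = 1\<close>.\<close>

lemma shifted_graph_fps_eq: "shifted_graph_fps = connected_fps * graph_fps"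
proof -
  have "(1 + t) ^ (Suc n choose 2) = (\<Sum>k\<le>n. of_nat (n choose k) *
      (connected_sum t {..k} * (1 + t) ^ ((n - k) choose 2)))" for n
    using cluster_sum_Suc[of 1 t n] by (simp add: cluster_sum_1)
  then show ?thesis
    unfolding shifted_graph_fps_def connected_fps_def graph_fps_def
    by (intro fps_mult_egf) (use q_pos in auto)
qed

text \<open>The factor \<open>q\<close> in \<open>H' = q C' H\<close> cancels against the
  \<open>1 / q\<close> that the chain rule gives for \<open>z / q\<close>.\<close>

lemma fps_deriv_cluster_fps: "fps_deriv cluster_fps = connected_fps * cluster_fps"
proof -
  have "fps_deriv cluster_fps
      = Abs_fps (\<lambda>n. (cluster_sum q t {..<Suc n} / q) / (q ^ n * fact n))"
  proof (rule fps_ext)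
    fix n
    have "fps_deriv cluster_fps $ n
        = real (Suc n) * (cluster_sum q t {..<Suc n} / (q ^ Suc n * fact (Suc n)))"
      by (simp add: cluster_fps_def)
    also have "fact (Suc n) = real (Suc n) * fact n"
      by simp
    finally show "fps_deriv cluster_fps $ n
        = Abs_fps (\<lambda>n. (cluster_sum q t {..<Suc n} / q) / (q ^ n * fact n)) $ n"
      by (simp del: fact_Suc of_nat_Suc)
  qed
  also have "\<dots> = connected_fps * cluster_fps"
    unfolding connected_fps_def cluster_fps_def
    using q_pos by (intro fps_mult_egf)
      (auto simp: cluster_sum_Suc sum_divide_distrib intro!: sum.cong)
  finally show ?thesis .
qed

lemma quotient_fps_graph_fps: "graph_fps * quotient_fps = cluster_fps"
proof -
  have "graph_fps $ 0 \<noteq> 0"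
    by (simp add: graph_fps_def)
  then show ?thesis
    using inverse_mult_eq_1'[of graph_fps] by (simp add: quotient_fps_def mult.left_commute)
qed

text \<open>The equation \<open>h' E(z / q) = h E'(z / q)\<close> with \<open>E(z / q)\<close>
  divided out.\<close>

lemma quotient_fps_shifted_graph_fps: "shifted_graph_fps * quotient_fps = fps_deriv cluster_fps"
  by (simp add: shifted_graph_fps_eq fps_deriv_cluster_fps quotient_fps_graph_fps mult.assoc)

text \<open>
  \<open>vol n a m\<close> is the volume of the set of continuations \<open>u\<^sub>1, \<dots>, u\<^sub>n\<close> of a sequence with last entry
  \<open>a\<close> and running minimum \<open>m\<close>. In \<open>b = a + (1 - q) / q * m\<close> the map \<open>step_bound\<close> becomes
  \<open>b \<mapsto> (1 + t) * b\<close>, so that the generating function of the volumes solves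
  \<open>\<Phi>'(b) = z (1 + t) \<Phi>((1 + t) b)\<close> and is a multiple of \<open>\<Sum>k. (1 + t) ^ (Suc k choose 2) (z b) ^ k / k!\<close>;
  the multiplier \<open>quotient_fps\<close> is fixed by the part of the integral below \<open>m\<close>.
\<close>

definition vol :: "nat \<Rightarrow> real \<Rightarrow> real \<Rightarrow> real" where
  "vol n a m = (\<Sum>k\<le>n. (1 + t) ^ (Suc k choose 2) / fact k * quotient_fps $ (n - k)
     * m ^ (n - k) * (a + (1 - q) / q * m) ^ k)"

definition vol_primitive :: "nat \<Rightarrow> real \<Rightarrow> real \<Rightarrow> real" where
  "vol_primitive n a m = (\<Sum>k\<le>n. (1 + t) ^ (Suc k choose 2) / fact (Suc k) * quotient_fps $ (n - k)
     * m ^ (n - k) * (a + (1 - q) / q * m) ^ Suc k)"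

definition step_bound :: "real \<Rightarrow> real \<Rightarrow> real" where
  "step_bound a m = (1 + t) * a + t * (1 - q) / q * m"

section \<open>Closed form of the volumes\<close>

text \<open>The variable \<open>b\<close> equals \<open>m / q\<close> when \<open>a = m\<close>,
  which is the source of the rescaling by \<open>z / q\<close>.\<close>

lemma diag_eq: "m + (1 - q) / q * m = m / q"
  using q_pos by (simp add: field_simps)

lemma vol_0: "vol 0 a m = 1"
proof -
  have "quotient_fps $ 0 = 1"
    using arg_cong[OF quotient_fps_graph_fps, of "\<lambda>f. f $ 0"]
    by (simp add: graph_fps_def cluster_fps_def cluster_sum_def num_components_eq numeral_2_eq_2)
  then show ?thesis
    by (simp add: vol_def numeral_2_eq_2)
qed

text \<open>On the diagonal the sum is \<open>m ^ n\<close> times a coefficient of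
  \<open>shifted_graph_fps * quotient_fps\<close>, which is \<open>h'\<close>.\<close>

lemma vol_diag: "vol n m m = real (Suc n) * cluster_fps $ Suc n * m ^ n"
proof -
  have "real (Suc n) * cluster_fps $ Suc n = (shifted_graph_fps * quotient_fps) $ n"
    by (simp add: quotient_fps_shifted_graph_fps)
  also have "\<dots> = (\<Sum>k\<le>n. (1 + t) ^ (Suc k choose 2) / (q ^ k * fact k) * quotient_fps $ (n - k))"
    by (simp add: fps_mult_nth shifted_graph_fps_def atLeast0AtMost)
  finally have "real (Suc n) * cluster_fps $ Suc n * m ^ n
      = (\<Sum>k\<le>n. (1 + t) ^ (Suc k choose 2) / (q ^ k * fact k) * quotient_fps $ (n - k) * m ^ n)"
    by (simp add: sum_distrib_right)
  also have "\<dots> = vol n m m"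
    unfolding vol_def diag_eq
  proof (rule sum.cong[OF refl])
    fix k assume "k \<in> {..n}"
    then have "m ^ n = m ^ (n - k) * m ^ k"
      by (simp add: power_add[symmetric])
    then show "(1 + t) ^ (Suc k choose 2) / (q ^ k * fact k) * quotient_fps $ (n - k) * m ^ n
        = (1 + t) ^ (Suc k choose 2) / fact k * quotient_fps $ (n - k) * m ^ (n - k) * (m / q) ^ k"
      by (simp add: power_divide mult_ac)
  qed
  finally show ?thesis ..
qed

text \<open>The sum gives a coefficient of \<open>graph_fps * quotient_fps\<close>, that is of
  \<open>h\<close>, except that its term with graph index 0 is missing.\<close>

lemma vol_primitive_diag:
  "vol_primitive n m m = (cluster_fps $ Suc n - quotient_fps $ Suc n) * m ^ Suc n"
proof -
  have "cluster_fps $ Suc n = (graph_fps * quotient_fps) $ Suc n"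
    by (simp add: quotient_fps_graph_fps)
  also have "\<dots> = quotient_fps $ Suc n
      + (\<Sum>k\<le>n. (1 + t) ^ (Suc k choose 2) / (q ^ Suc k * fact (Suc k)) * quotient_fps $ (n - k))"
    unfolding fps_mult_nth atLeast0AtMost sum.atMost_Suc_shift
    by (simp add: graph_fps_def numeral_2_eq_2 del: fact_Suc power_Suc)
  finally have "(cluster_fps $ Suc n - quotient_fps $ Suc n) * m ^ Suc n
      = (\<Sum>k\<le>n. (1 + t) ^ (Suc k choose 2) / (q ^ Suc k * fact (Suc k)) * quotient_fps $ (n - k) * m ^ Suc n)"
    by (simp add: sum_distrib_right del: fact_Suc power_Suc)
  also have "\<dots> = vol_primitive n m m"
    unfolding vol_primitive_def diag_eq
  proof (rule sum.cong[OF refl])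
    fix k assume "k \<in> {..n}"
    then have "m ^ Suc n = m ^ (n - k) * m ^ Suc k"
      by (simp add: power_add[symmetric] del: power_Suc)
    then show "(1 + t) ^ (Suc k choose 2) / (q ^ Suc k * fact (Suc k)) * quotient_fps $ (n - k) * m ^ Suc n
        = (1 + t) ^ (Suc k choose 2) / fact (Suc k) * quotient_fps $ (n - k) * m ^ (n - k) * (m / q) ^ Suc k"
      by (simp add: power_divide mult_ac del: fact_Suc power_Suc)
  qed
  finally show ?thesis ..
qed

text \<open>The integral recursion, integrated out. The first term is the integral of
  \<open>vol n u u\<close> over \<open>u\<close> from 0 to \<open>m\<close>, where the new entry
  becomes the minimum; the bracket is that of \<open>vol n u m\<close> from \<open>m\<close> to
  \<open>step_bound a m\<close>, where the minimum stays.\<close>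

lemma vol_Suc:
  "vol (Suc n) a m = cluster_fps $ Suc n * m ^ Suc n
     + (vol_primitive n (step_bound a m) m - vol_primitive n m m)"
proof -
  let ?b = "a + (1 - q) / q * m"
  have b: "step_bound a m + (1 - q) / q * m = (1 + t) * ?b"
    using q_pos by (simp add: step_bound_def field_simps)
  have "vol (Suc n) a m = quotient_fps $ Suc n * m ^ Suc n
     + (\<Sum>k\<le>n. (1 + t) ^ (Suc (Suc k) choose 2) / fact (Suc k) * quotient_fps $ (n - k)
     * m ^ (n - k) * ?b ^ Suc k)"
    unfolding vol_def sum.atMost_Suc_shift
    by (simp add: binomial_eq_0 del: fact_Suc power_Suc binomial_Suc_Suc)
  also have "(\<Sum>k\<le>n. (1 + t) ^ (Suc (Suc k) choose 2) / fact (Suc k) * quotient_fps $ (n - k)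
     * m ^ (n - k) * ?b ^ Suc k) = vol_primitive n (step_bound a m) m"
    unfolding vol_primitive_def b
  proof (rule sum.cong[OF refl])
    fix k
    \<comment> \<open>The surplus factor \<open>(1 + t) ^ Suc k\<close> is what scaling
      \<open>b\<close> by \<open>1 + t\<close> produces.\<close>
    have "(Suc (Suc k) choose 2) = (Suc k choose 2) + Suc k"
      by (simp add: numeral_2_eq_2)
    then show "(1 + t) ^ (Suc (Suc k) choose 2) / fact (Suc k) * quotient_fps $ (n - k)
     * m ^ (n - k) * ?b ^ Suc k = (1 + t) ^ (Suc k choose 2) / fact (Suc k) * quotient_fps $ (n - k)
     * m ^ (n - k) * ((1 + t) * ?b) ^ Suc k"
      by (simp only: power_add power_mult_distrib times_divide_eq_left times_divide_eq_right mult_ac)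
  qed
  finally show ?thesis
    by (simp add: vol_primitive_diag algebra_simps)
qed

lemma DERIV_vol_primitive: "((\<lambda>a. vol_primitive n a m) has_real_derivative vol n a m) (at a)"
  unfolding vol_primitive_def vol_def
proof (rule DERIV_sum)
  fix k
  have "((\<lambda>a. c * (a + d) ^ Suc k) has_real_derivative c * (real (Suc k) * (a + d) ^ k)) (at a)" for c d
    by (rule derivative_eq_intros refl | simp)+
  moreover have "x / fact (Suc k) * y * z * (real (Suc k) * w) = x / fact k * y * z * w"
    for x y z w :: real
    by (simp add: field_simps del: of_nat_Suc)
  ultimately show "((\<lambda>a. (1 + t) ^ (Suc k choose 2) / fact (Suc k) * quotient_fps $ (n - k)
     * m ^ (n - k) * (a + (1 - q) / q * m) ^ Suc k) has_real_derivative
     (1 + t) ^ (Suc k choose 2) / fact k * quotient_fps $ (n - k)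
     * m ^ (n - k) * (a + (1 - q) / q * m) ^ k) (at a)"
    by metis
qed

lemma cluster_fps_nonneg: "0 \<le> cluster_fps $ n"
  using q_pos t_pos by (simp add: cluster_fps_def cluster_sum_def sum_nonneg)

lemma step_bound_ge:
  assumes "0 \<le> m" "m \<le> a"
  shows "m \<le> step_bound a m"
proof -
  have "0 \<le> t * a" "0 \<le> t * (1 - q) / q * m"
    using assms q_pos q_le_1 t_pos by simp_all
  then show ?thesis
    using assms by (simp add: step_bound_def algebra_simps)
qed

text \<open>Not visible from the formula, since \<open>quotient_fps\<close> can have negative
  coefficients (that of \<open>z\<close> is \<open>1 - 1 / q\<close>). In \<open>vol_Suc\<close> the
  primitive is increasing by induction.\<close>

lemma vol_nonneg: "0 \<le> m \<Longrightarrow> m \<le> a \<Longrightarrow> 0 \<le> vol n a m"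
proof (induction n arbitrary: a)
  case 0
  then show ?case by (simp add: vol_0)
next
  case (Suc n)
  have "vol_primitive n m m \<le> vol_primitive n (step_bound a m) m"
  proof (rule DERIV_nonneg_imp_nondecreasing[where f = "\<lambda>a. vol_primitive n a m"])
    show "m \<le> step_bound a m"
      by (rule step_bound_ge[OF Suc.prems])
    show "\<exists>D. ((\<lambda>a. vol_primitive n a m) has_real_derivative D) (at y) \<and> 0 \<le> D"
      if "m \<le> y" for y
      using DERIV_vol_primitive Suc.IH[OF Suc.prems(1) that] by blast
  qed
  then show ?case
    using Suc.prems cluster_fps_nonneg[of "Suc n"] by (simp add: vol_Suc)
qed

text \<open>
  \<open>chain n k a m x\<close> constrains only the coordinates \<open>k + 1, \<dots>, k + n\<close> of \<open>x\<close>; \<open>a\<close> stands for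
  \<open>x\<^sub>k\<close> and \<open>m\<close> for \<open>min(x\<^sub>0, \<dots>, x\<^sub>k)\<close>, neither of them shifted by \<open>1 - q\<close>.
\<close>

primrec chain :: "nat \<Rightarrow> nat \<Rightarrow> real \<Rightarrow> real \<Rightarrow> (nat \<Rightarrow> real) \<Rightarrow> bool" where
  "chain 0 k a m x \<longleftrightarrow> True"
| "chain (Suc n) k a m x \<longleftrightarrow>
     1 - q \<le> x (Suc k) \<and> x (Suc k) \<le> 1 - q + step_bound (a - (1 - q)) (m - (1 - q)) \<and>
     chain n (Suc k) (x (Suc k)) (min m (x (Suc k))) x"

section \<open>The volume as an iterated integral\<close>

lemma chain_cong: "(\<And>i. k < i \<Longrightarrow> x i = y i) \<Longrightarrow> chain n k a m x \<longleftrightarrow> chain n k a m y"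
  by (induction n arbitrary: k a m) auto

text \<open>The state is allowed to vary with the point because the recursive call puts coordinates
  in for \<open>a\<close> and \<open>m\<close>.\<close>

lemma measurable_chain [measurable (raw)]:
  assumes "f \<in> borel_measurable N" "g \<in> borel_measurable N"
    and "\<And>i. i \<in> {k<..k + n} \<Longrightarrow> (\<lambda>x. X x i) \<in> borel_measurable N"
  shows "Measurable.pred N (\<lambda>x. chain n k (f x) (g x) (X x))"
  using assms
proof (induction n arbitrary: k f g)
  case 0
  then show ?case by simp
next
  case (Suc n)
  have [measurable]: "(\<lambda>x. X x (Suc k)) \<in> borel_measurable N"
    using Suc.prems(3) by simp
  note [measurable] = Suc.prems(1,2)
  have chain: "Measurable.pred N (\<lambda>x. chain n (Suc k) (X x (Suc k)) (min (g x) (X x (Suc k))) (X x))"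
  proof (rule Suc.IH)
    show "(\<lambda>x. X x i) \<in> borel_measurable N" if "i \<in> {Suc k<..Suc k + n}" for i
      using that by (intro Suc.prems(3)) simp
  qed measurable
  show ?case
    unfolding chain.simps
  proof (intro pred_intros_logic chain)
    define h where "h x = 1 - q + step_bound (f x - (1 - q)) (g x - (1 - q))" for x
    have [measurable]: "h \<in> borel_measurable N"
      unfolding h_def step_bound_def
      by (intro borel_measurable_add borel_measurable_times borel_measurable_diff
          borel_measurable_const Suc.prems(1,2))
    show "Measurable.pred N (\<lambda>x. 1 - q \<le> X x (Suc k))"
      by measurable
    have "Measurable.pred N (\<lambda>x. X x (Suc k) \<le> h x)"
      by measurable
    then show "Measurable.pred N (\<lambda>x. X x (Suc k)
        \<le> 1 - q + step_bound (f x - (1 - q)) (g x - (1 - q)))"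
      by (simp only: h_def)
  qed
qed

text \<open>Integrate the first coordinate last, apply induction to the others, cut at
  \<open>m\<close>, and recognise the two pieces as those of \<open>vol_Suc\<close>.\<close>

lemma nn_integral_chain:
  assumes "1 - q \<le> m" "m \<le> a"
  shows "(\<integral>\<^sup>+x. of_bool (chain n k a m x) \<partial>Pi\<^sub>M {k<..k + n} (\<lambda>_. lborel))
    = ennreal (vol n (a - (1 - q)) (m - (1 - q)))"
  using assms
proof (induction n arbitrary: k a m)
  case 0
  then show ?case
    by (simp add: vol_0 PiM_empty nn_integral_count_space_finite)
next
  case (Suc n)
  interpret product_sigma_finite "\<lambda>_ :: nat. lborel :: real measure"
    by standard
  define d where "d = 1 - q"
  define b where "b = step_bound (a - d) (m - d)"
  have md: "0 \<le> m - d" "m - d \<le> a - d" "m \<le> d + b"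
    using Suc.prems step_bound_ge[of "m - d" "a - d"] by (auto simp: d_def b_def)
  have ins: "{k<..k + Suc n} = insert (Suc k) {Suc k<..Suc k + n}"
    by auto
  have "(\<integral>\<^sup>+x. of_bool (chain (Suc n) k a m x) \<partial>Pi\<^sub>M {k<..k + Suc n} (\<lambda>_. lborel))
      = (\<integral>\<^sup>+y. \<integral>\<^sup>+x. of_bool (chain (Suc n) k a m (x(Suc k := y)))
          \<partial>Pi\<^sub>M {Suc k<..Suc k + n} (\<lambda>_. lborel) \<partial>lborel)"
    unfolding ins
  proof (rule product_nn_integral_insert_rev)
    show "(\<lambda>x. of_bool (chain (Suc n) k a m x) :: ennreal)
        \<in> borel_measurable (Pi\<^sub>M (insert (Suc k) {Suc k<..Suc k + n}) (\<lambda>_. lborel))"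
    proof -
      have [measurable]: "Measurable.pred (Pi\<^sub>M (insert (Suc k) {Suc k<..Suc k + n}) (\<lambda>_. lborel))
          (\<lambda>x. chain (Suc n) k a m x)"
        by (rule measurable_chain) (auto intro: measurable_coordinate)
      show ?thesis
        by measurable
    qed
  qed auto
  also have "\<dots> = (\<integral>\<^sup>+y. ennreal (vol n (y - d) (min m y - d)) * indicator {d..d + b} y \<partial>lborel)"
  proof (rule nn_integral_cong)
    fix y :: real
    have "chain n (Suc k) y (min m y) (x(Suc k := y)) \<longleftrightarrow> chain n (Suc k) y (min m y) x" for x
      by (rule chain_cong) auto
    then have "of_bool (chain (Suc n) k a m (x(Suc k := y)))
        = (indicator {d..d + b} y * of_bool (chain n (Suc k) y (min m y) x) :: ennreal)" for x
      by (auto simp: d_def b_def split: split_indicator)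
    then have "(\<integral>\<^sup>+x. of_bool (chain (Suc n) k a m (x(Suc k := y))) \<partial>Pi\<^sub>M {Suc k<..Suc k + n} (\<lambda>_. lborel))
      = indicator {d..d + b} y * (\<integral>\<^sup>+x. of_bool (chain n (Suc k) y (min m y) x) \<partial>Pi\<^sub>M {Suc k<..Suc k + n} (\<lambda>_. lborel))"
      by (simp only:) (subst nn_integral_cmult, auto intro!: measurable_chain measurable_coordinate)
    also have "\<dots> = indicator {d..d + b} y * ennreal (vol n (y - d) (min m y - d))"
      using Suc.IH[of "min m y" y "Suc k"] Suc.prems
      by (auto simp: d_def split: split_indicator)
    finally show "(\<integral>\<^sup>+x. of_bool (chain (Suc n) k a m (x(Suc k := y))) \<partial>Pi\<^sub>M {Suc k<..Suc k + n} (\<lambda>_. lborel))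
      = ennreal (vol n (y - d) (min m y - d)) * indicator {d..d + b} y"
      by (simp add: mult.commute)
  qed
  \<comment> \<open>Below \<open>m\<close> the new coordinate is the minimum, above it
    \<open>m\<close> remains so. Both intervals contain the point \<open>m\<close>, so equality is
    only almost everywhere.\<close>
  also have "\<dots> = (\<integral>\<^sup>+y. ennreal (vol n (y - d) (y - d)) * indicator {d..m} y
      + ennreal (vol n (y - d) (m - d)) * indicator {m..d + b} y \<partial>lborel)"
    using AE_lborel_singleton[of m] md
    by (intro nn_integral_cong_AE) (auto elim!: eventually_mono split: split_indicator simp: min_def)
  also have "\<dots> = (\<integral>\<^sup>+y. ennreal (vol n (y - d) (y - d)) * indicator {d..m} y \<partial>lborel)
      + (\<integral>\<^sup>+y. ennreal (vol n (y - d) (m - d)) * indicator {m..d + b} y \<partial>lborel)"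
    unfolding vol_def by (intro nn_integral_add) measurable
  also have "(\<integral>\<^sup>+y. ennreal (vol n (y - d) (y - d)) * indicator {d..m} y \<partial>lborel)
      = cluster_fps $ Suc n * (m - d) ^ Suc n - cluster_fps $ Suc n * (d - d) ^ Suc n"
  proof (rule nn_integral_FTC_Icc[where F = "\<lambda>y. cluster_fps $ Suc n * (y - d) ^ Suc n"])
    show "((\<lambda>y. cluster_fps $ Suc n * (y - d) ^ Suc n) has_real_derivative
        vol n (y - d) (y - d)) (at y)" for y
      unfolding vol_diag by (rule derivative_eq_intros refl | simp)+
    show "0 \<le> vol n (y - d) (y - d)" if "y \<in> {d..m}" for y
      using that by (intro vol_nonneg) auto
  qed (use md in \<open>auto simp: vol_diag\<close>)
  also have "(\<integral>\<^sup>+y. ennreal (vol n (y - d) (m - d)) * indicator {m..d + b} y \<partial>lborel)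
      = vol_primitive n (d + b - d) (m - d) - vol_primitive n (m - d) (m - d)"
  proof (rule nn_integral_FTC_Icc[where F = "\<lambda>y. vol_primitive n (y - d) (m - d)"])
    show "((\<lambda>y. vol_primitive n (y - d) (m - d)) has_real_derivative
        vol n (y - d) (m - d)) (at y)" for y
    proof -
      have "((\<lambda>y. y - d) has_real_derivative 1) (at y)"
        by (rule derivative_eq_intros refl | simp)+
      from DERIV_chain2[OF DERIV_vol_primitive this] show ?thesis
        by simp
    qed
    show "0 \<le> vol n (y - d) (m - d)" if "y \<in> {m..d + b}" for y
      using that md by (intro vol_nonneg) auto
    show "(\<lambda>y. vol n (y - d) (m - d)) \<in> borel_measurable borel"
      unfolding vol_def by measurable
  qed (use md in auto)
  also have "ennreal (cluster_fps $ Suc n * (m - d) ^ Suc n - cluster_fps $ Suc n * (d - d) ^ Suc n)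
      + ennreal (vol_primitive n (d + b - d) (m - d) - vol_primitive n (m - d) (m - d))
      = ennreal (vol (Suc n) (a - d) (m - d))"
  proof (subst ennreal_plus[symmetric])
    show "0 \<le> cluster_fps $ Suc n * (m - d) ^ Suc n - cluster_fps $ Suc n * (d - d) ^ Suc n"
      using cluster_fps_nonneg md by simp
    have "vol_primitive n (m - d) (m - d) \<le> vol_primitive n b (m - d)"
    proof (rule DERIV_nonneg_imp_nondecreasing[where f = "\<lambda>y. vol_primitive n y (m - d)"])
      show "m - d \<le> b"
        using md by simp
      show "\<exists>D. ((\<lambda>y. vol_primitive n y (m - d)) has_real_derivative D) (at y) \<and> 0 \<le> D"
        if "m - d \<le> y" for y
        using that md(1) DERIV_vol_primitive vol_nonneg by blast
    qed
    then show "0 \<le> vol_primitive n (d + b - d) (m - d) - vol_primitive n (m - d) (m - d)"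
      by simp
  qed (simp add: vol_Suc b_def)
  finally show ?case
    by (simp add: d_def)
qed

section \<open>The polytope as a chain, and its volume\<close>

text \<open>Unrolls the recursion: the minimum carried along is that of the whole prefix, index 0
  included.\<close>

lemma chain_iff:
  assumes y: "y = x(0 := 1)"
  shows "chain n k (y k) (Min (y ` {..k})) x \<longleftrightarrow>
    (\<forall>i\<in>{k<..k + n}. 1 - q \<le> y i \<and>
      y i \<le> 1 - q + step_bound (y (i - 1) - (1 - q)) (Min (y ` {..<i}) - (1 - q)))"
proof (induction n arbitrary: k)
  case 0
  then show ?case by simp
next
  case (Suc n)
  have "{k<..k + Suc n} = insert (Suc k) {Suc k<..Suc k + n}"
    by auto
  moreover have "min (Min (y ` {..k})) (y (Suc k)) = Min (y ` {..Suc k})"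
    by (simp add: atMost_Suc min.commute)
  ultimately show ?case
    using Suc.IH[of "Suc k"] by (simp add: y lessThan_Suc_atMost)
qed

lemma tutte_polytope_eq:
  assumes "n \<ge> 1"
  shows "tutte_polytope n q t = {x \<in> {1..n} \<rightarrow>\<^sub>E UNIV. chain n 0 1 1 x}"
proof -
  have "x \<in> tutte_polytope n q t \<longleftrightarrow> chain n 0 1 1 x" if x: "x \<in> {1..n} \<rightarrow>\<^sub>E UNIV" for x
  proof -
    define y where "y = x(0 := 1)"
    define C where "C i j \<longleftrightarrow> q * y i \<le> q * (1 + t) * y (i - 1) - t * (1 - q) * (1 - y (j - 1))" for i j
    \<comment> \<open>The right side of \<open>C i j\<close> grows with \<open>y (j - 1)\<close>
      because \<open>t * (1 - q) \<ge> 0\<close>, so the constraints for all \<open>j\<close> amount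
      to the one at the minimum of the prefix.\<close>
    have bound: "y i \<le> 1 - q + step_bound (y (i - 1) - (1 - q)) (Min (y ` {..<i}) - (1 - q))
        \<longleftrightarrow> (\<forall>j. 1 \<le> j \<and> j \<le> i \<longrightarrow> C i j)" if "1 \<le> i" for i
    proof -
      define \<mu> where "\<mu> = Min (y ` {..<i})"
      have "\<mu> \<in> y ` {..<i}"
        unfolding \<mu>_def by (rule Min_in) (use that in \<open>auto simp: lessThan_empty_iff\<close>)
      then obtain l where l: "l < i" "\<mu> = y l" by auto
      have le: "\<mu> \<le> y (j - 1)" if "1 \<le> j" "j \<le> i" for j
        unfolding \<mu>_def by (rule Min_le) (use that in auto)
      have "1 - q + step_bound (y (i - 1) - (1 - q)) (\<mu> - (1 - q))
          = (q * (1 + t) * y (i - 1) - t * (1 - q) * (1 - \<mu>)) / q"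
        using q_pos by (simp add: step_bound_def field_simps)
      then have "y i \<le> 1 - q + step_bound (y (i - 1) - (1 - q)) (\<mu> - (1 - q))
          \<longleftrightarrow> q * y i \<le> q * (1 + t) * y (i - 1) - t * (1 - q) * (1 - \<mu>)"
        using q_pos by (simp add: pos_le_divide_eq mult.commute)
      also have "\<dots> \<longleftrightarrow> (\<forall>j. 1 \<le> j \<and> j \<le> i \<longrightarrow> C i j)"
      proof
        assume *: "q * y i \<le> q * (1 + t) * y (i - 1) - t * (1 - q) * (1 - \<mu>)"
        show "\<forall>j. 1 \<le> j \<and> j \<le> i \<longrightarrow> C i j"
        proof (intro allI impI, elim conjE)
          fix j assume "1 \<le> j" "j \<le> i"
          then have "t * (1 - q) * (1 - y (j - 1)) \<le> t * (1 - q) * (1 - \<mu>)"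
            using le[of j] t_pos q_le_1 by (intro mult_left_mono) auto
          with * show "C i j" by (simp add: C_def)
        qed
      next
        assume "\<forall>j. 1 \<le> j \<and> j \<le> i \<longrightarrow> C i j"
        \<comment> \<open>The minimum is attained at index \<open>l\<close>, which is
          \<open>j - 1\<close> for \<open>j = Suc l\<close>.\<close>
        then have "C i (Suc l)" using l by simp
        then show "q * y i \<le> q * (1 + t) * y (i - 1) - t * (1 - q) * (1 - \<mu>)"
          by (simp add: C_def l)
      qed
      finally show ?thesis by (simp add: \<mu>_def)
    qed
    \<comment> \<open>Downward induction from \<open>n\<close>: for \<open>j = i\<close> the
      constraint reads \<open>q * y i \<le> (q + t) * y (i - 1) - t * (1 - q)\<close>, so the lower
      bound passes from \<open>y i\<close> to \<open>y (i - 1)\<close>.\<close>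
    have lower: "1 - q \<le> y i" if "1 - q \<le> y n" and C: "\<And>i. 1 \<le> i \<Longrightarrow> i \<le> n \<Longrightarrow> C i i" and "i \<le> n" for i
      using \<open>i \<le> n\<close>
    proof (induction rule: inc_induct)
      case base
      then show ?case by (rule that(1))
    next
      case (step i)
      have "C (Suc i) (Suc i)"
        using step by (intro C) auto
      then have "q * y (Suc i) \<le> q * (1 + t) * y i - t * (1 - q) * (1 - y i)"
        by (simp add: C_def)
      moreover have "q * (1 - q) \<le> q * y (Suc i)"
        using step q_pos by (intro mult_left_mono) auto
      ultimately have "(q + t) * (1 - q) \<le> (q + t) * y i"
        by (simp add: algebra_simps)
      then show ?case
        using q_pos t_pos by simp
    qed
    have "x \<in> tutte_polytope n q t \<longleftrightarrow> 1 - q \<le> y n \<and> (\<forall>i j. 1 \<le> j \<and> j \<le> i \<and> i \<le> n \<longrightarrow> C i j)"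
    proof -
      have xy: "x i = y i" if "1 \<le> i" for i
        using that by (simp add: y_def)
      have iff: "(1 \<le> j \<and> j \<le> i \<and> i \<le> n \<longrightarrow>
          q * x i \<le> q * (1 + t) * y (i - 1) - t * (1 - q) * (1 - y (j - 1)))
          \<longleftrightarrow> (1 \<le> j \<and> j \<le> i \<and> i \<le> n \<longrightarrow> C i j)" for i j
      proof (cases "1 \<le> j \<and> j \<le> i")
        case True
        then show ?thesis
          by (simp only: C_def xy[of i, OF order_trans[of 1 j i]])
      qed blast
      have "x \<in> tutte_polytope n q t \<longleftrightarrow> 1 - q \<le> x n \<and>
          (\<forall>i j. 1 \<le> j \<and> j \<le> i \<and> i \<le> n \<longrightarrow>
            q * x i \<le> q * (1 + t) * y (i - 1) - t * (1 - q) * (1 - y (j - 1)))"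
        using x unfolding tutte_polytope_def mem_Collect_eq y_def[symmetric] by blast
      then show ?thesis
        unfolding iff xy[OF assms] .
    qed
    also have "\<dots> \<longleftrightarrow> (\<forall>i\<in>{0<..0 + n}. 1 - q \<le> y i \<and> (\<forall>j. 1 \<le> j \<and> j \<le> i \<longrightarrow> C i j))"
    proof (intro iffI ballI conjI)
      fix i
      assume H: "1 - q \<le> y n \<and> (\<forall>i j. 1 \<le> j \<and> j \<le> i \<and> i \<le> n \<longrightarrow> C i j)"
        and i: "i \<in> {0<..0 + n}"
      have C: "C i j" if "1 \<le> j" "j \<le> i" "i \<le> n" for i j
        using H that by blast
      show "1 - q \<le> y i"
      proof (rule lower)
        show "1 - q \<le> y n"
          using H by (rule conjunct1)
        show "i \<le> n"
          using i by simp
      qed (rule C, simp_all)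
      show "\<forall>j. 1 \<le> j \<and> j \<le> i \<longrightarrow> C i j"
      proof (intro allI impI, elim conjE)
        show "C i j" if "1 \<le> j" "j \<le> i" for j
          using that i by (intro C) simp_all
      qed
    next
      assume *: "\<forall>i\<in>{0<..0 + n}. 1 - q \<le> y i \<and> (\<forall>j. 1 \<le> j \<and> j \<le> i \<longrightarrow> C i j)"
      have "n \<in> {0<..0 + n}"
        using assms by simp
      then show "1 - q \<le> y n"
        using * by blast
      show "\<forall>i j. 1 \<le> j \<and> j \<le> i \<and> i \<le> n \<longrightarrow> C i j"
      proof (intro allI impI, elim conjE)
        show "C i j" if "1 \<le> j" "j \<le> i" "i \<le> n" for i j
        proof -
          have "i \<in> {0<..0 + n}"
            using that by simp
          then show ?thesis
            using * that by blast
        qed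
      qed
    qed
    also have "\<dots> \<longleftrightarrow> (\<forall>i\<in>{0<..0 + n}. 1 - q \<le> y i \<and>
        y i \<le> 1 - q + step_bound (y (i - 1) - (1 - q)) (Min (y ` {..<i}) - (1 - q)))"
      using bound by (intro ball_cong) auto
    also have "\<dots> \<longleftrightarrow> chain n 0 (y 0) (Min (y ` {..0})) x"
      by (rule chain_iff[symmetric]) (rule y_def)
    finally show ?thesis
      by (simp add: y_def)
  qed
  moreover have "tutte_polytope n q t \<subseteq> {1..n} \<rightarrow>\<^sub>E UNIV"
    unfolding tutte_polytope_def by (rule Collect_restrict)
  ultimately show ?thesis
    by blast
qed

lemma measure_tutte_polytope:
  assumes "n \<ge> 1"
  shows "measure (lebesgue_n n) (tutte_polytope n q t) = cluster_sum q t {..<Suc n} / (q * fact n)"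
proof -
  let ?M = "Pi\<^sub>M {1..n} (\<lambda>_. lborel) :: (nat \<Rightarrow> real) measure"
  have I: "{1..n} = {0<..0 + n}"
    by auto
  have P: "tutte_polytope n q t = {x \<in> space ?M. chain n 0 1 1 x}"
    using assms by (simp add: tutte_polytope_eq space_PiM)
  have [measurable]: "Measurable.pred ?M (chain n 0 1 1)"
    by (rule measurable_chain) (auto intro: measurable_coordinate)
  have sets: "tutte_polytope n q t \<in> sets ?M"
    unfolding P by measurable
  have "emeasure ?M (tutte_polytope n q t) = (\<integral>\<^sup>+x. indicator (tutte_polytope n q t) x \<partial>?M)"
    by (rule nn_integral_indicator[OF sets, symmetric])
  also have "\<dots> = (\<integral>\<^sup>+x. of_bool (chain n 0 1 1 x) \<partial>?M)"
    by (intro nn_integral_cong) (auto simp: P split: split_indicator)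
  \<comment> \<open>The start \<open>x 0 = 1\<close> is both last entry and minimum; shifted by
    \<open>1 - q\<close> it becomes \<open>q\<close>.\<close>
  also have "\<dots> = ennreal (vol n q q)"
    unfolding I by (subst nn_integral_chain) (use q_pos in auto)
  finally have "measure ?M (tutte_polytope n q t) = vol n q q"
    using q_pos by (simp add: measure_def vol_nonneg)
  also have "\<dots> = cluster_sum q t {..<Suc n} / (q * fact n)"
    using q_pos by (simp add: vol_diag cluster_fps_def field_simps del: of_nat_Suc)
  \<comment> \<open>Completion keeps the measure of a set that is already measurable.\<close>
  finally show ?thesis
    using sets by (simp add: lebesgue_n_def)
qed

end

theorem theorem1p3:
  fixes n :: nat and q t :: real
  assumes "n \<ge> 1" and "0 < q" and "q \<le> 1" and "t > 0"
  shows "measure (lebesgue_n n) (tutte_polytope n q t) =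
           t ^ n * tutte (complete_graph (n + 1)) (1 + q / t) (1 + t) / fact n"
proof -
  interpret tutte_parameters q t
    using assms by unfold_locales
  show ?thesis
    using measure_tutte_polytope[OF assms(1)] tutte_complete_graph[of q t n] assms by simp
qed

end
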